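(* Let $X$ and $Y$ be operator spaces, $n\in\mathbb{N}$, and let $f:X\to Y$ be an $n$-isometry such that $\overline{\mathrm{span}}_{\mathbb{R}}\{f(X)\}=Y$ and $f(0)=0$. Then there exists a unique $\mathbb{R}$-linear map $T:Y\to X$ such that $\|T_n\|_n=1$ and $T\circ f=\mathrm{Id}_X$.
   Context: Operator spaces are closed linear subspaces of $\mathcal{B}(H)$, $H$ a complex Hilbert space; $\mathrm{M}_n(X)$ has the norm inherited from $\mathcal{B}(H^{\oplus n})$. For a map $f:X\to Y$ (not necessarily linear) its $n$-th amplification is $f_n:\mathrm{M}_n(X)\to\mathrm{M}_n(Y)$, $f_n([x_{ij}])=[f(x_{ij})]$; $f$ is an $n$-isometry if $f_n$ is an isometry (distance preserving, not assumed onto). $\|T_n\|_n$ is the operator norm of $T_n:\mathrm{M}_n(Y)\to\mathrm{M}_n(X)$. $\overline{\mathrm{span}}_{\mathbb{R}}$ denotes closed $\mathbb{R}$-linear span.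
   Formalization: The formal statement assumes in addition that X is not {0}: for X = {0} the conditions force Y = {0} and T = 0, so the norm of T_n is 0 and the claim that it equals 1 fails. *)

theory Defs
  imports "HOL-Analysis.Analysis"
begin

(* Complex Hilbert spaces.  The inner product is linear in its first argument.
   The axiom scaleR_scaleC makes the complex structure extend the given real one. *)

class chilbert_space = banach +
  fixes scaleC :: "complex \<Rightarrow> 'a \<Rightarrow> 'a" (infixr "*\<^sub>C" 75)
    and cinner :: "'a \<Rightarrow> 'a \<Rightarrow> complex"
  assumes scaleC_add_right: "c *\<^sub>C (x + y) = c *\<^sub>C x + c *\<^sub>C y"
    and scaleC_add_left: "(c + d) *\<^sub>C x = c *\<^sub>C x + d *\<^sub>C x"
    and scaleC_scaleC: "c *\<^sub>C d *\<^sub>C x = (c * d) *\<^sub>C x"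
    and scaleC_one: "1 *\<^sub>C x = x"
    and scaleR_scaleC: "r *\<^sub>R x = complex_of_real r *\<^sub>C x"
    and cinner_add_left: "cinner (x + y) z = cinner x z + cinner y z"
    and cinner_scaleC_left: "cinner (c *\<^sub>C x) y = c * cinner x y"
    and cinner_commute: "cinner x y = cnj (cinner y x)"
    and cinner_ge_zero: "0 \<le> Re (cinner x x)"
    and cinner_eq_zero_iff: "cinner x x = 0 \<longleftrightarrow> x = 0"
    and norm_eq_sqrt_cinner: "norm x = sqrt (Re (cinner x x))"

lemma norm_scaleC: "norm (c *\<^sub>C x) = cmod c * norm (x :: 'a :: chilbert_space)"
proof -
  have "cinner (c *\<^sub>C x) (c *\<^sub>C x) = c * cnj (c * cinner x x)"
    by (metis cinner_commute cinner_scaleC_left)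
  also have "\<dots> = (c * cnj c) * cinner x x"
    by (metis cinner_commute complex_cnj_mult mult.assoc)
  also have "\<dots> = complex_of_real ((cmod c)\<^sup>2) * cinner x x"
    by (simp only: complex_norm_square)
  finally have "Re (cinner (c *\<^sub>C x) (c *\<^sub>C x)) = (cmod c)\<^sup>2 * Re (cinner x x)"
    by (simp only: Re_complex_of_real times_complex.sel Im_complex_of_real)
  then show ?thesis
    by (simp add: norm_eq_sqrt_cinner real_sqrt_mult)
qed

lemma bounded_linear_scaleC: "bounded_linear (\<lambda>x :: 'a :: chilbert_space. c *\<^sub>C x)"
proof (rule bounded_linear_intro[where K = "cmod c"])
  show "c *\<^sub>C (x + y) = c *\<^sub>C x + c *\<^sub>C y" for x y :: 'a
    by (rule scaleC_add_right)
  show "c *\<^sub>C r *\<^sub>R x = r *\<^sub>R c *\<^sub>C x" for r and x :: 'a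
    by (simp add: scaleR_scaleC scaleC_scaleC mult.commute)
  show "norm (c *\<^sub>C x) \<le> norm x * cmod c" for x :: 'a
    by (simp add: norm_scaleC mult.commute)
qed

(* The type 'h \<Rightarrow>\<^sub>L 'h consists of the bounded R-linear operators with the
   operator norm, so B(H) is its subset of complex-linear elements. *)

definition clinear_ops :: "('h::chilbert_space \<Rightarrow>\<^sub>L 'h) set" where
  "clinear_ops = {A. \<forall>c h. blinfun_apply A (c *\<^sub>C h) = c *\<^sub>C blinfun_apply A h}"

lift_definition scaleC_op ::
  "complex \<Rightarrow> ('h::chilbert_space \<Rightarrow>\<^sub>L 'h) \<Rightarrow> ('h \<Rightarrow>\<^sub>L 'h)"
  is "\<lambda>c A h. c *\<^sub>C A h"
  by (rule bounded_linear_compose[OF bounded_linear_scaleC])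

definition operator_space :: "('h::chilbert_space \<Rightarrow>\<^sub>L 'h) set \<Rightarrow> bool" where
  "operator_space X \<longleftrightarrow>
     X \<subseteq> clinear_ops \<and> closed X \<and> 0 \<in> X \<and>
     (\<forall>A\<in>X. \<forall>B\<in>X. A + B \<in> X) \<and> (\<forall>c. \<forall>A\<in>X. scaleC_op c A \<in> X)"

(* The index type 'n of n x n matrices has CARD('n) = n >= 1. *)

definition matrices_over :: "('h::chilbert_space \<Rightarrow>\<^sub>L 'h) set \<Rightarrow> (('h \<Rightarrow>\<^sub>L 'h)^'n::finite^'n) set" where
  "matrices_over X = {A. \<forall>i j. A $ i $ j \<in> X}"

(* The norm of B(H^n): the library norm on 'h^'n is the l2-norm, i.e. the norm of the
   Hilbert space direct sum.  It is not the library norm of the matrix type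
   ('h \<Rightarrow>\<^sub>L 'h)^'n^'n, which is the l2-norm of the entries. *)

definition mat_norm :: "('h::chilbert_space \<Rightarrow>\<^sub>L 'h)^'n^'n::finite \<Rightarrow> real" where
  "mat_norm A = onorm (\<lambda>h :: 'h^'n. \<chi> i. \<Sum>j\<in>UNIV. blinfun_apply (A $ i $ j) (h $ j))"

definition amplification :: "('a \<Rightarrow> 'b) \<Rightarrow> 'a^'n^'n::finite \<Rightarrow> 'b^'n^'n" where
  "amplification f A = (\<chi> i j. f (A $ i $ j))"

definition n_isometry ::
  "'n::finite itself \<Rightarrow> ('h::chilbert_space \<Rightarrow>\<^sub>L 'h) set \<Rightarrow> ('k::chilbert_space \<Rightarrow>\<^sub>L 'k) set \<Rightarrow>
    (('h \<Rightarrow>\<^sub>L 'h) \<Rightarrow> ('k \<Rightarrow>\<^sub>L 'k)) \<Rightarrow> bool" where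
  "n_isometry (_ :: 'n itself) X Y f \<longleftrightarrow>
     f \<in> X \<rightarrow> Y \<and>
     (\<forall>A\<in>matrices_over X. \<forall>B\<in>matrices_over X :: (('h \<Rightarrow>\<^sub>L 'h)^'n^'n) set.
        mat_norm (amplification f A - amplification f B) = mat_norm (A - B))"

definition real_linear_on :: "'a::real_vector set \<Rightarrow> ('a \<Rightarrow> 'b::real_vector) \<Rightarrow> bool" where
  "real_linear_on Y T \<longleftrightarrow>
     (\<forall>x\<in>Y. \<forall>y\<in>Y. T (x + y) = T x + T y) \<and> (\<forall>r. \<forall>y\<in>Y. T (r *\<^sub>R y) = r *\<^sub>R T y)"

(* The operator norm of the n-th amplification on the matrices over Y.  It is extended-real
   valued, so that it is \<infinity> for unbounded maps, where a supremum in type real would be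
   an unspecified number. *)

definition amplification_norm ::
  "'n::finite itself \<Rightarrow> ('k::chilbert_space \<Rightarrow>\<^sub>L 'k) set \<Rightarrow>
    (('k \<Rightarrow>\<^sub>L 'k) \<Rightarrow> ('h::chilbert_space \<Rightarrow>\<^sub>L 'h)) \<Rightarrow> ereal" where
  "amplification_norm (_ :: 'n itself) Y T =
     (SUP A\<in>{A \<in> matrices_over Y :: (('k \<Rightarrow>\<^sub>L 'k)^'n^'n) set. mat_norm A \<le> 1}.
        ereal (mat_norm (amplification T A)))"

end

theory Submission
  imports Defs
begin

text \<open>
  The theorem is Figiel's theorem on isometric embeddings, applied to the amplification of $f$
  on $n \times n$ matrices. Figiel's theorem rests on one inequality: an isometry $f$ with
  $f(0) = 0$ satisfies $\|\sum_i c_i x_i\| \le \|\sum_i c_i f(x_i)\|$ for all finite real linear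
  combinations (\<open>figiel_inequality\<close>).

  The inequality is seen along a line through a point $x$ at which the norm is smooth. For large
  $N$ the points $Nx$, $0$, $-Nx$ are mapped to points at the same mutual distances, so a
  functional $\varphi$ of norm one that is large on $f(Nx) - f(-Nx)$ must send $f(Nx)$ close to
  $N\|x\|$ and $f(-Nx)$ close to $-N\|x\|$. Then $\varphi(f(y))$ is caught between
  $N\|x\| - \|Nx - y\|$ and $\|Nx + y\| - N\|x\|$, and both tend to the derivative $L(y)$ of the
  norm at $x$ in the direction $y$ (\<open>isometry_functional\<close>). As $L$ is linear,
  $\|\sum_i c_i f(x_i)\| \ge \varphi(\sum_i c_i f(x_i)) \approx L(\sum_i c_i x_i)$,
  and $L(z)$ is close to $\|z\|$ if $x$ is close to $z$.

  Only finitely many directions matter, so approximate smoothness suffices. A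
  near-maximizer of the norm minus a steep paraboloid centred at $z$ is close to $z$, and there
  the norm has a paraboloid touching it from above; for a convex function this bounds the
  derivative from both sides by the linear part of the paraboloid
  (\<open>almost_smooth_point\<close>).

  Since $f(0) = 0$, the amplification of $f$ maps a matrix with one nonzero entry to a matrix of the
  same kind, so the real span of its image consists of all matrices over the span of $f(X)$. The
  inequality therefore says that $f(x) \mapsto x$ extends to a linear map on the span of $f(X)$
  whose amplification is a contraction. It extends by continuity to $Y$; in terms of graphs, one
  takes the closure of the span of all pairs $(f(x), x)$ (\<open>inverse_relation\<close>). The graph of
  every admissible map lies in this closure, which is uniqueness
  (\<open>left_inverse_relation\<close>).
\<close>

section \<open>Almost smooth points of a seminorm\<close>

lemma near_maximizer:
  fixes G :: "'a \<Rightarrow> real"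
  assumes "\<And>a. G a \<le> B" "\<delta> > 0"
  obtains a where "\<And>b. G b \<le> G a + \<delta>"
proof -
  have bdd: "bdd_above (range G)"
    using assms(1) by (auto simp: bdd_above_def)
  have "\<exists>y\<in>range G. Sup (range G) - \<delta> < y"
    using assms(2) by (intro less_cSupD) auto
  then obtain a where a: "Sup (range G) - \<delta> < G a" by auto
  have "G b \<le> G a + \<delta>" for b
    using cSup_upper[OF rangeI bdd, of b] a by linarith
  then show ?thesis by (rule that)
qed

text \<open>
  Write $X(a) = \sum_i a_i x_i$ and $z = X(c)$. At a near-maximizer $a$ of
  $p(X(a)) - K \sum_i (a_i - c_i)^2$ the seminorm lies below the sum of $p(X(a))$, the linear form with
  coefficients $L_i = 2K(a_i - c_i)$ and a quadratic error. The point $v$ is the dilation of $X(a)$ by a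
  large factor $1/s$: by homogeneity a unit step at $v$ is a step of length $s$ at $X(a)$, where
  the quadratic error is small compared with $s$. A large $K$ forces $X(a)$ to be close to $z$,
  and so $\sum_i c_i L_i$ almost reaches $p(z)$.
\<close>

lemma almost_smooth_point:
  fixes p :: "'a::real_vector \<Rightarrow> real" and x :: "'i \<Rightarrow> 'a"
  assumes triangle: "\<And>x y. p (x + y) \<le> p x + p y"
    and homogeneous: "\<And>r x. p (r *\<^sub>R x) = \<bar>r\<bar> * p x"
    and I: "finite I" and \<epsilon>: "\<epsilon> > 0"
  obtains v L where "v \<in> span (x ` I)"
    and "\<And>i. i \<in> I \<Longrightarrow> p (v + x i) \<le> p v + L i + \<epsilon>"
    and "\<And>i. i \<in> I \<Longrightarrow> p (v - x i) \<le> p v - L i + \<epsilon>"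
    and "p (\<Sum>i\<in>I. c i *\<^sub>R x i) - \<epsilon> \<le> (\<Sum>i\<in>I. c i * L i)"
proof -
  define X where "X a = (\<Sum>i\<in>I. a i *\<^sub>R x i)" for a
  define M where "M = (\<Sum>i\<in>I. (p (x i))\<^sup>2)"
  define C where "C = (\<Sum>i\<in>I. (c i)\<^sup>2)"
  define K where "K = 4 * M / \<epsilon> + 1"
  define s where "s = min 1 (\<epsilon> / (2 * (3 + K * C + K)))"
  have M0: "M \<ge> 0" and C0: "C \<ge> 0" by (auto simp: M_def C_def intro: sum_nonneg)
  have K: "K > 0" using M0 \<epsilon> by (simp add: K_def add_nonneg_pos)
  have D: "3 + K * C + K > 0" using K C0 by (simp add: add_pos_nonneg add_pos_pos)
  have s: "s > 0" "s \<le> 1" using \<epsilon> D by (auto simp: s_def)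
  have sD: "s * (3 + K * C + K) \<le> \<epsilon> / 2"
  proof -
    have "s \<le> \<epsilon> / (2 * (3 + K * C + K))" by (simp add: s_def)
    then show ?thesis using D by (simp add: field_simps)
  qed
  have MK: "2 * (M / K) \<le> \<epsilon> / 2"
  proof -
    have "4 * M \<le> K * \<epsilon>" using \<epsilon> by (simp add: K_def field_simps)
    then show ?thesis using K by (simp add: field_simps)
  qed
  have X_add: "X (\<lambda>i. a i + r * b i) = X a + r *\<^sub>R X b" for a b r
    by (simp add: X_def scaleR_add_left sum.distrib scaleR_sum_right)
  have p0: "p 0 = 0" using homogeneous[of 0 0] by simp
  have p_sum: "p (\<Sum>i\<in>J. b i *\<^sub>R x i) \<le> (\<Sum>i\<in>J. \<bar>b i\<bar> * p (x i))" if "finite J" for J b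
    using that
  proof (induction J)
    case (insert j J)
    then show ?case
      using triangle[of "b j *\<^sub>R x j" "\<Sum>i\<in>J. b i *\<^sub>R x i"] by (simp add: homogeneous)
  qed (simp add: p0)
  \<comment> \<open>Young's inequality trades the linear growth of $p$ for half of the penalty $K \sum_i b_i^2$;
    the remaining $M / (2K)$ is small for large $K$.\<close>
  have p_X: "p (X b) \<le> M / (2 * K) + K / 2 * (\<Sum>i\<in>I. (b i)\<^sup>2)" for b
  proof -
    have young: "\<bar>t\<bar> * m \<le> m\<^sup>2 / (2 * K) + K / 2 * t\<^sup>2" for t m :: real
    proof -
      have "0 \<le> (m - K * \<bar>t\<bar>)\<^sup>2" by simp
      then have "2 * K * (\<bar>t\<bar> * m) \<le> m\<^sup>2 + K\<^sup>2 * t\<^sup>2"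
        by (simp add: power2_diff power_mult_distrib algebra_simps)
      then show ?thesis using K by (simp add: field_simps power2_eq_square)
    qed
    have "p (X b) \<le> (\<Sum>i\<in>I. \<bar>b i\<bar> * p (x i))"
      using p_sum[OF I] by (simp add: X_def)
    also have "\<dots> \<le> (\<Sum>i\<in>I. (p (x i))\<^sup>2 / (2 * K) + K / 2 * (b i)\<^sup>2)"
      by (intro sum_mono young)
    finally show ?thesis
      by (simp add: M_def sum.distrib sum_divide_distrib sum_distrib_left)
  qed
  define G where "G a = p (X a) - K * (\<Sum>i\<in>I. (a i - c i)\<^sup>2)" for a
  have X_diff: "p (X a) \<le> p (X c) + p (X (\<lambda>i. a i - c i))" for a
    using triangle[of "X c" "X (\<lambda>i. a i - c i)"] X_add[of c 1 "\<lambda>i. a i - c i"] by simp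
  have "G a \<le> p (X c) + M / (2 * K)" for a
  proof -
    have "0 \<le> K / 2 * (\<Sum>i\<in>I. (a i - c i)\<^sup>2)"
      using K by (intro mult_nonneg_nonneg sum_nonneg) auto
    then show ?thesis
      using X_diff[of a] p_X[of "\<lambda>i. a i - c i"] by (simp add: G_def)
  qed
  then obtain a where a: "\<And>b. G b \<le> G a + s\<^sup>2"
    using near_maximizer[of G _ "s\<^sup>2"] s(1) by (metis zero_less_power)
  define L where "L i = 2 * K * (a i - c i)" for i
  define r where "r = K * (\<Sum>i\<in>I. (a i - c i)\<^sup>2)"
  \<comment> \<open>The tolerance $s^2$ in the choice of $a$ is of the order of the quadratic error of a step of size $s$.\<close>
  have parabola: "p (X a + t *\<^sub>R X b)
      \<le> p (X a) + t * (\<Sum>i\<in>I. b i * L i) + t\<^sup>2 * K * (\<Sum>i\<in>I. (b i)\<^sup>2) + s\<^sup>2" for b t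
  proof -
    have "K * (\<Sum>i\<in>I. (a i + t * b i - c i)\<^sup>2) =
        r + t * (\<Sum>i\<in>I. b i * L i) + t\<^sup>2 * K * (\<Sum>i\<in>I. (b i)\<^sup>2)"
      by (simp add: r_def L_def sum_distrib_left sum.distrib[symmetric])
         (intro sum.cong refl, simp add: power2_eq_square algebra_simps)
    then show ?thesis
      using a[of "\<lambda>i. a i + t * b i"] by (simp add: G_def X_add r_def)
  qed
  \<comment> \<open>Comparison of $a$ with the centre $c$ bounds the penalty at $a$.\<close>
  have r: "r \<le> M / K + 2 * s\<^sup>2"
    using a[of c] X_diff[of a] p_X[of "\<lambda>i. a i - c i"] by (simp add: G_def r_def)
  define v where "v = (1 / s) *\<^sub>R X a"
  have scale: "s * p (v + w) = p (X a + s *\<^sub>R w)" for w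
    using homogeneous[of s "v + w"] s by (simp add: v_def scaleR_add_right)
  have dir: "p (v + t *\<^sub>R X b) \<le> p v + t * (\<Sum>i\<in>I. b i * L i) + s * (t\<^sup>2 * K * (\<Sum>i\<in>I. (b i)\<^sup>2) + 1)" for t b
  proof -
    have "s * p (v + t *\<^sub>R X b) \<le> s * (p v + t * (\<Sum>i\<in>I. b i * L i) + s * (t\<^sup>2 * K * (\<Sum>i\<in>I. (b i)\<^sup>2) + 1))"
      using parabola[of "s * t" b] scale[of 0] scale[of "t *\<^sub>R X b"]
      by (simp add: algebra_simps power2_eq_square)
    then show ?thesis using s by simp
  qed
  show ?thesis
  proof (rule that[of v L])
    show "v \<in> span (x ` I)"
      unfolding v_def X_def by (intro span_scale span_sum) (simp add: span_base)
  next
    fix i assume i: "i \<in> I"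
    have eps: "s * (K + 1) \<le> \<epsilon>"
    proof -
      have "s * (K + 1) \<le> s * (3 + K * C + K)"
        using s K C0 by (intro mult_left_mono) auto
      then show ?thesis using sD \<epsilon> by linarith
    qed
    have e: "X (\<lambda>j. of_bool (j = i)) = x i" 
      using i I by (simp add: X_def if_distrib[of "\<lambda>r. r *\<^sub>R _"] of_bool_def cong: if_cong)
    have e1: "(\<Sum>j\<in>I. of_bool (j = i) * L j) = L i" 
      using i I by (simp add: of_bool_def if_distrib[of "\<lambda>r. r * _"] cong: if_cong)
    have e2: "(\<Sum>j\<in>I. (of_bool (j = i) :: real)\<^sup>2) = 1"
      using i I by (simp add: of_bool_def if_distrib[of "\<lambda>r. r\<^sup>2"] cong: if_cong)
    show "p (v + x i) \<le> p v + L i + \<epsilon>"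
      using dir[of 1 "\<lambda>j. of_bool (j = i)"] eps unfolding e e1 e2 by simp
    show "p (v - x i) \<le> p v - L i + \<epsilon>"
      using dir[of "-1" "\<lambda>j. of_bool (j = i)"] eps unfolding e e1 e2 by simp
  next
    define d where "d = X (\<lambda>i. a i - c i)"
    have d: "X a = X c + d"
      using X_add[of c 1 "\<lambda>i. a i - c i"] by (simp add: d_def)
    have pd: "p d \<le> M / K + s\<^sup>2"
      using p_X[of "\<lambda>i. a i - c i"] r K by (simp add: d_def r_def[symmetric] field_simps)
    \<comment> \<open>The direction of $z = X(c)$ is almost the radial direction of $X(a)$, along which $p$ grows linearly.\<close>
    have "(1 + 1 / s) * p (X a) \<le> p (v + X c) + p d"
    proof -
      have "(1 + 1 / s) *\<^sub>R X a = (v + X c) + d"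
        by (simp add: v_def d scaleR_add_left)
      then show ?thesis
        using homogeneous[of "1 + 1 / s" "X a"] triangle[of "v + X c" d] s by simp
    qed
    moreover have "p v = p (X a) / s"
      using homogeneous[of "1 / s" "X a"] s by (simp add: v_def)
    moreover have "p (X c) \<le> p (X a) + p d"
      using triangle[of "X a" "- d"] homogeneous[of "-1" d] d by simp
    ultimately have "p (X c) - 2 * p d + p v \<le> p (v + X c)"
      by (simp add: algebra_simps)
    then have "p (X c) - 2 * (M / K + s\<^sup>2) - s * (K * C + 1) \<le> (\<Sum>i\<in>I. c i * L i)"
      using dir[of 1 c] pd by (simp add: C_def)
    moreover have "2 * s\<^sup>2 + s * (K * C + 1) \<le> \<epsilon> / 2"
    proof -
      have "s\<^sup>2 \<le> s" using s by (simp add: power2_eq_square mult_left_le)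
      moreover have "s * K \<ge> 0" using s K by simp
      ultimately show ?thesis using sD by (simp add: algebra_simps)
    qed
    ultimately show "p (\<Sum>i\<in>I. c i *\<^sub>R x i) - \<epsilon> \<le> (\<Sum>i\<in>I. c i * L i)"
      using MK unfolding X_def distrib_left[of 2 "M / K" "s\<^sup>2"] by linarith
  qed
qed

section \<open>Figiel's inequality\<close>

text \<open>
  The image of the segment from $-v$ to $v$ has endpoints at distance $2 p(v)$, and each
  endpoint is at distance $p(v)$ from $f(0) = 0$. A functional below $q$ that nearly attains
  $q(f(v) - f(-v))$ thus takes nearly its extreme possible values at the two endpoints. The
  bounds at a point $f(x)$ follow by comparison with the endpoints.
\<close>

lemma isometry_functional:
  fixes p :: "'a::real_vector \<Rightarrow> real" and q :: "'b::real_vector \<Rightarrow> real"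
  assumes X: "subspace X"
    and homogeneous: "\<And>r x. p (r *\<^sub>R x) = \<bar>r\<bar> * p x"
    and norming: "\<And>w \<epsilon>. 0 < \<epsilon> \<Longrightarrow> \<exists>\<phi>. linear \<phi> \<and> (\<forall>w. \<phi> w \<le> q w) \<and> q w - \<epsilon> \<le> \<phi> w"
    and isometry: "\<And>x y. x \<in> X \<Longrightarrow> y \<in> X \<Longrightarrow> q (f x - f y) = p (x - y)"
    and f0: "f 0 = 0" and v: "v \<in> X" and \<epsilon>: "\<epsilon> > 0"
  obtains \<phi> :: "'b \<Rightarrow> real" where "linear \<phi>" "\<And>w. \<phi> w \<le> q w"
    and "\<And>x. x \<in> X \<Longrightarrow> \<phi> (f x) \<le> p (v + x) - p v + \<epsilon>"
    and "\<And>x. x \<in> X \<Longrightarrow> p v - p (v - x) - \<epsilon> \<le> \<phi> (f x)"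
proof -
  have 0: "0 \<in> X" and v': "- v \<in> X" using X v by (auto simp: subspace_0 subspace_neg)
  obtain \<phi> where \<phi>: "linear \<phi>" "\<And>w. \<phi> w \<le> q w" "q (f v - f (- v)) - \<epsilon> \<le> \<phi> (f v - f (- v))"
    using norming[OF \<epsilon>] by blast
  have bound: "\<phi> (f x) - \<phi> (f y) \<le> p (x - y)" if "x \<in> X" "y \<in> X" for x y
    using \<phi>(2)[of "f x - f y"] isometry[OF that] by (simp add: linear_diff[OF \<phi>(1)])
  have pv: "p (v - - v) = 2 * p v" "p (- v) = p v"
    using homogeneous[of 2 v] homogeneous[of "-1" v] by (simp_all add: scaleR_2)
  have \<phi>0: "\<phi> 0 = 0" using \<phi>(1) by (rule linear_0)
  have ends: "\<phi> (f v) \<le> p v" "- p v \<le> \<phi> (f (- v))"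
    using bound[OF v 0] bound[OF 0 v'] by (simp_all add: f0 \<phi>0)
  have "2 * p v - \<epsilon> \<le> \<phi> (f v) - \<phi> (f (- v))"
    using \<phi>(3) by (simp add: isometry[OF v v'] pv(1)[simplified] linear_diff[OF \<phi>(1)])
  with ends have "p v - \<epsilon> \<le> \<phi> (f v)" "\<phi> (f (- v)) \<le> - p v + \<epsilon>"
    by linarith+
  note ends = this
  show ?thesis
  proof (rule that[OF \<phi>(1,2)])
    fix x assume x: "x \<in> X"
    show "\<phi> (f x) \<le> p (v + x) - p v + \<epsilon>"
      using bound[OF x v'] ends(2) by (simp add: add.commute)
    show "p v - p (v - x) - \<epsilon> \<le> \<phi> (f x)"
      using bound[OF v x] ends(1) by linarith
  qed
qed

text \<open>
  The seminorm $q$ enters only through linear functionals below it. For a norm their existence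
  is the Hahn-Banach theorem; for operators on a Hilbert space they are
  $A \mapsto \mathrm{Re} \langle A h, k \rangle$.
\<close>

theorem figiel_inequality:
  fixes p :: "'a::real_vector \<Rightarrow> real" and q :: "'b::real_vector \<Rightarrow> real"
  assumes X: "subspace X"
    and triangle: "\<And>x y. p (x + y) \<le> p x + p y"
    and homogeneous: "\<And>r x. p (r *\<^sub>R x) = \<bar>r\<bar> * p x"
    and norming: "\<And>w \<epsilon>. 0 < \<epsilon> \<Longrightarrow> \<exists>\<phi>. linear \<phi> \<and> (\<forall>w. \<phi> w \<le> q w) \<and> q w - \<epsilon> \<le> \<phi> w"
    and isometry: "\<And>x y. x \<in> X \<Longrightarrow> y \<in> X \<Longrightarrow> q (f x - f y) = p (x - y)"
    and f0: "f 0 = 0"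
    and I: "finite I" and x: "\<And>i. i \<in> I \<Longrightarrow> x i \<in> X"
  shows "p (\<Sum>i\<in>I. c i *\<^sub>R x i) \<le> q (\<Sum>i\<in>I. c i *\<^sub>R f (x i))"
proof -
  define S where "S = 1 + 2 * (\<Sum>i\<in>I. \<bar>c i\<bar>)"
  have S: "S > 0" by (simp add: S_def add_pos_nonneg sum_nonneg)
  have approx: "p (\<Sum>i\<in>I. c i *\<^sub>R x i) \<le> q (\<Sum>i\<in>I. c i *\<^sub>R f (x i)) + \<epsilon> * S" if \<epsilon>: "\<epsilon> > 0" for \<epsilon>
  proof -
    obtain v L where v: "v \<in> span (x ` I)"
      and plus: "\<And>i. i \<in> I \<Longrightarrow> p (v + x i) \<le> p v + L i + \<epsilon>"
      and minus: "\<And>i. i \<in> I \<Longrightarrow> p (v - x i) \<le> p v - L i + \<epsilon>"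
      and L: "p (\<Sum>i\<in>I. c i *\<^sub>R x i) - \<epsilon> \<le> (\<Sum>i\<in>I. c i * L i)"
      by (rule almost_smooth_point[where p = p and x = x and c = c, OF triangle homogeneous I \<epsilon>]) (rule that)
    have vX: "v \<in> X" using v span_minimal[OF _ X, of "x ` I"] x by auto
    obtain \<phi> where \<phi>: "linear \<phi>" "\<And>w. \<phi> w \<le> q w"
      and upper: "\<And>x. x \<in> X \<Longrightarrow> \<phi> (f x) \<le> p (v + x) - p v + \<epsilon>"
      and lower: "\<And>x. x \<in> X \<Longrightarrow> p v - p (v - x) - \<epsilon> \<le> \<phi> (f x)"
      by (rule isometry_functional[where p = p and q = q and f = f, OF X homogeneous norming isometry f0 vX \<epsilon>]) (assumption | rule that)+
    have close: "c i * L i \<le> c i * \<phi> (f (x i)) + \<bar>c i\<bar> * (2 * \<epsilon>)" if "i \<in> I" for i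
    proof -
      have "\<bar>L i - \<phi> (f (x i))\<bar> \<le> 2 * \<epsilon>"
        using plus[OF that] minus[OF that] upper[OF x[OF that]] lower[OF x[OF that]] by linarith
      then have "\<bar>c i\<bar> * \<bar>L i - \<phi> (f (x i))\<bar> \<le> \<bar>c i\<bar> * (2 * \<epsilon>)"
        by (rule mult_left_mono) simp
      then have "c i * (L i - \<phi> (f (x i))) \<le> \<bar>c i\<bar> * (2 * \<epsilon>)"
        using abs_ge_self[of "c i * (L i - \<phi> (f (x i)))"] by (simp only: abs_mult)
      then show ?thesis by (simp add: algebra_simps)
    qed
    have "(\<Sum>i\<in>I. c i * L i) \<le> (\<Sum>i\<in>I. c i * \<phi> (f (x i)) + \<bar>c i\<bar> * (2 * \<epsilon>))"
      by (intro sum_mono close)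
    also have "\<dots> = \<phi> (\<Sum>i\<in>I. c i *\<^sub>R f (x i)) + \<epsilon> * (S - 1)"
      by (simp add: S_def sum.distrib linear_sum[OF \<phi>(1)] linear_scale[OF \<phi>(1)] sum_distrib_left mult_ac)
    finally show ?thesis
      using L \<phi>(2)[of "\<Sum>i\<in>I. c i *\<^sub>R f (x i)"] by (simp add: algebra_simps)
  qed
  show ?thesis
  proof (rule field_le_epsilon)
    fix e :: real assume "e > 0"
    then show "p (\<Sum>i\<in>I. c i *\<^sub>R x i) \<le> q (\<Sum>i\<in>I. c i *\<^sub>R f (x i)) + e"
      using approx[of "e / S"] S by simp
  qed
qed

corollary figiel_span:
  fixes p :: "'a::real_vector \<Rightarrow> real" and q :: "'b::real_vector \<Rightarrow> real"
  assumes X: "subspace X"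
    and triangle: "\<And>x y. p (x + y) \<le> p x + p y"
    and homogeneous: "\<And>r x. p (r *\<^sub>R x) = \<bar>r\<bar> * p x"
    and norming: "\<And>w \<epsilon>. 0 < \<epsilon> \<Longrightarrow> \<exists>\<phi>. linear \<phi> \<and> (\<forall>w. \<phi> w \<le> q w) \<and> q w - \<epsilon> \<le> \<phi> w"
    and isometry: "\<And>x y. x \<in> X \<Longrightarrow> y \<in> X \<Longrightarrow> q (f x - f y) = p (x - y)"
    and f0: "f 0 = 0"
    and wz: "(w, z) \<in> span ((\<lambda>x. (f x, x)) ` X)"
  shows "p z \<le> q w"
proof -
  obtain t r where t: "finite t" "t \<subseteq> (\<lambda>x. (f x, x)) ` X" and sum: "(w, z) = (\<Sum>a\<in>t. r a *\<^sub>R a)"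
    using wz unfolding span_explicit by blast
  have "z = (\<Sum>a\<in>t. r a *\<^sub>R snd a)"
    using arg_cong[OF sum, of snd] by (simp add: snd_sum)
  moreover have "w = (\<Sum>a\<in>t. r a *\<^sub>R f (snd a))"
    using arg_cong[OF sum, of fst] t(2) by (auto simp: fst_sum intro!: sum.cong)
  moreover have "p (\<Sum>a\<in>t. r a *\<^sub>R snd a) \<le> q (\<Sum>a\<in>t. r a *\<^sub>R f (snd a))"
    by (rule figiel_inequality[OF X triangle homogeneous norming isometry f0 t(1)]) (use t(2) in auto)
  ultimately show ?thesis by simp
qed

section \<open>Operator norms of matrices\<close>

lemma Re_cinner_le: "Re (cinner x y) \<le> norm x * norm (y :: 'h::chilbert_space)"
proof -
  have sq: "Re (cinner z z) = (norm z)\<^sup>2" for z :: 'h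
    by (simp add: norm_eq_sqrt_cinner cinner_ge_zero)
  have add: "Re (cinner (a + b) c) = Re (cinner a c) + Re (cinner b c)" for a b c :: 'h
    by (simp add: cinner_add_left)
  have scale: "Re (cinner (r *\<^sub>R a) c) = r * Re (cinner a c)" for r and a c :: 'h
    by (simp add: scaleR_scaleC cinner_scaleC_left)
  have comm: "Re (cinner a c) = Re (cinner c a)" for a c :: 'h
    by (subst cinner_commute) simp
  have add': "Re (cinner a (b + c)) = Re (cinner a b) + Re (cinner a c)" for a b c :: 'h
    using add[of b c a] comm[of a] by simp
  have scale': "Re (cinner a (r *\<^sub>R c)) = r * Re (cinner a c)" for r and a c :: 'h
    using scale[of r c a] comm[of a] by simp
  define a b where "a = norm x" and "b = norm y"
  have "0 \<le> Re (cinner (b *\<^sub>R x + (- a) *\<^sub>R y) (b *\<^sub>R x + (- a) *\<^sub>R y))"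
    by (rule cinner_ge_zero)
  also have "\<dots> = b * (b * Re (cinner x x) - a * Re (cinner x y)) - a * (b * Re (cinner x y) - a * Re (cinner y y))"
    by (simp only: add scale add' scale' comm[of y x]) (simp add: algebra_simps)
  also have "\<dots> = 2 * (a * b) * (a * b - Re (cinner x y))"
    by (simp add: sq a_def[symmetric] b_def[symmetric] power2_eq_square algebra_simps)
  finally have *: "0 \<le> (a * b) * (a * b - Re (cinner x y))" by simp
  show ?thesis
  proof (cases "a * b = 0")
    case True
    then have "x = 0 \<or> y = 0" by (simp add: a_def b_def)
    then show ?thesis
      using scale[of 0 x y] scale[of 0 y x] comm[of x y] by auto
  next
    case False
    then have "a * b > 0" by (simp add: a_def b_def)
    then show ?thesis using * by (simp add: zero_le_mult_iff a_def b_def)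
  qed
qed

definition mat_apply :: "('h::chilbert_space \<Rightarrow>\<^sub>L 'h)^'n^'n::finite \<Rightarrow> 'h^'n \<Rightarrow> 'h^'n" where
  "mat_apply A h = (\<chi> i. \<Sum>j\<in>UNIV. blinfun_apply (A $ i $ j) (h $ j))"

lemma mat_norm_eq_onorm: "mat_norm A = onorm (mat_apply A)"
  by (simp add: mat_norm_def mat_apply_def[abs_def])

lemma norm_vec_le_sum: "norm (v :: 'a::real_normed_vector^'n::finite) \<le> (\<Sum>i\<in>UNIV. norm (v $ i))"
  by (simp add: norm_vec_def L2_set_le_sum)

lemma norm_mat_apply_le:
  "norm (mat_apply A h) \<le> (\<Sum>i\<in>UNIV. \<Sum>j\<in>UNIV. norm (A $ i $ j)) * norm h"
proof -
  have "norm (mat_apply A h $ i) \<le> (\<Sum>j\<in>UNIV. norm (A $ i $ j)) * norm h" for i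
  proof -
    have "norm (mat_apply A h $ i) \<le> (\<Sum>j\<in>UNIV. norm (A $ i $ j) * norm h)"
      unfolding mat_apply_def vec_lambda_beta
      by (intro sum_norm_le order_trans[OF norm_blinfun] mult_left_mono Finite_Cartesian_Product.norm_nth_le norm_ge_zero)
    then show ?thesis by (simp add: sum_distrib_right)
  qed
  then show ?thesis
    by (intro order_trans[OF norm_vec_le_sum]) (auto simp: sum_distrib_right intro: sum_mono)
qed

lemma mat_apply_add: "mat_apply (A + B) h = mat_apply A h + mat_apply B h"
  by (simp add: mat_apply_def vec_eq_iff blinfun.add_left sum.distrib)

lemma mat_apply_scaleR: "mat_apply (r *\<^sub>R A) h = r *\<^sub>R mat_apply A h"
  by (simp add: mat_apply_def vec_eq_iff blinfun.scaleR_left scaleR_sum_right)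

lemma bounded_linear_mat_apply: "bounded_linear (mat_apply A)"
proof (rule bounded_linear_intro)
  show "mat_apply A (x + y) = mat_apply A x + mat_apply A y" for x y
    by (simp add: mat_apply_def vec_eq_iff blinfun.add_right sum.distrib)
  show "mat_apply A (r *\<^sub>R x) = r *\<^sub>R mat_apply A x" for r x
    by (simp add: mat_apply_def vec_eq_iff blinfun.scaleR_right scaleR_sum_right)
  show "norm (mat_apply A x) \<le> norm x * (\<Sum>i\<in>UNIV. \<Sum>j\<in>UNIV. norm (A $ i $ j))" for x
    using norm_mat_apply_le[of A x] by (simp add: mult.commute)
qed

lemma mat_norm_nonneg: "0 \<le> mat_norm A"
  by (simp add: mat_norm_eq_onorm onorm_pos_le bounded_linear_mat_apply)

lemma mat_norm_triangle: "mat_norm (A + B) \<le> mat_norm A + mat_norm B"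
  using onorm_triangle[OF bounded_linear_mat_apply[of A] bounded_linear_mat_apply[of B]]
  by (simp add: mat_norm_eq_onorm mat_apply_add[abs_def])

lemma mat_norm_scaleR: "mat_norm (r *\<^sub>R A) = \<bar>r\<bar> * mat_norm A"
  using onorm_scaleR[OF bounded_linear_mat_apply[of A], of r]
  by (simp add: mat_norm_eq_onorm mat_apply_scaleR[abs_def])

lemma mat_norm_le_sum: "mat_norm A \<le> (\<Sum>i\<in>UNIV. \<Sum>j\<in>UNIV. norm (A $ i $ j))"
  unfolding mat_norm_eq_onorm
  by (rule onorm_bound[OF _ norm_mat_apply_le]) (simp add: sum_nonneg)

lemma norm_axis_vec: "norm (axis i x :: 'a::real_normed_vector^'n::finite) = norm x"
  unfolding norm_vec_def axis_def L2_set_def by (simp add: if_distrib[of norm] if_distrib[of "\<lambda>r. r\<^sup>2"] cong: if_cong)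

lemma norm_entry_le_mat_norm: "norm (A $ i $ j) \<le> mat_norm A"
proof (rule norm_blinfun_bound[OF mat_norm_nonneg])
  fix x
  have "blinfun_apply (A $ i $ j) x = mat_apply A (axis j x) $ i"
    by (simp add: mat_apply_def axis_def if_distrib[of "blinfun_apply _"] blinfun.zero_right cong: if_cong)
  also have "norm \<dots> \<le> norm (mat_apply A (axis j x))"
    by (rule Finite_Cartesian_Product.norm_nth_le)
  also have "\<dots> \<le> mat_norm A * norm (axis j x)"
    unfolding mat_norm_eq_onorm by (rule onorm[OF bounded_linear_mat_apply])
  finally show "norm (blinfun_apply (A $ i $ j) x) \<le> mat_norm A * norm x"
    by (simp add: norm_axis_vec)
qed

text \<open>
  If $h$ nearly attains the operator norm of $A$ and $k = A h$, then the functional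
  $B \mapsto \mathrm{Re} \langle B h, k \rangle / (\|h\| \|k\|)$ has the required property by the
  Cauchy-Schwarz inequality.
\<close>

lemma mat_norm_norming:
  fixes A :: "('h::chilbert_space \<Rightarrow>\<^sub>L 'h)^'n^'n::finite"
  assumes "\<epsilon> > 0"
  shows "\<exists>\<phi>. linear \<phi> \<and> (\<forall>B. \<phi> B \<le> mat_norm B) \<and> mat_norm A - \<epsilon> \<le> \<phi> A"
proof (cases "mat_norm A \<le> \<epsilon>")
  case True
  then have "linear (\<lambda>_. 0 :: real) \<and> (\<forall>B. 0 \<le> mat_norm B) \<and> mat_norm A - \<epsilon> \<le> 0"
    by (simp add: mat_norm_nonneg linear_zero)
  then show ?thesis by (rule exI[where x = "\<lambda>_. 0"])
next
  case False
  obtain h where h: "(mat_norm A - \<epsilon>) * norm h < norm (mat_apply A h)"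
  proof (rule ccontr)
    assume "\<not> thesis"
    then have "\<And>h. norm (mat_apply A h) \<le> (mat_norm A - \<epsilon>) * norm h"
      using that not_less by blast
    then have "mat_norm A \<le> mat_norm A - \<epsilon>"
      using False by (subst mat_norm_eq_onorm) (intro onorm_bound, simp_all)
    then show False using assms by simp
  qed
  define k where "k = mat_apply A h"
  have k: "norm k > 0"
    using h False unfolding k_def by (smt (verit) mult_nonneg_nonneg norm_ge_zero)
  have h0: "norm h > 0"
    using k linear_0[OF bounded_linear.linear[OF bounded_linear_mat_apply[of A]]] by (auto simp: k_def)
  define b where "b x = (\<Sum>i\<in>UNIV. Re (cinner (x $ i) (k $ i)))" for x :: "'h^'n"
  have b_le: "b x \<le> norm x * norm k" for x
  proof -
    have "b x \<le> (\<Sum>i\<in>UNIV. \<bar>norm (x $ i)\<bar> * \<bar>norm (k $ i)\<bar>)"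
      unfolding b_def by (intro sum_mono) (simp add: Re_cinner_le)
    also have "\<dots> \<le> norm x * norm k"
      unfolding norm_vec_def by (rule L2_set_mult_ineq)
    finally show ?thesis .
  qed
  have b_k: "b k = norm k * norm k"
    by (simp add: b_def norm_vec_def L2_set_def norm_eq_sqrt_cinner cinner_ge_zero sum_nonneg)
  define \<phi> where "\<phi> B = b (mat_apply B h) / (norm h * norm k)" for B
  have "linear \<phi>"
    by (rule linearI)
      (simp_all add: \<phi>_def b_def mat_apply_add mat_apply_scaleR cinner_add_left scaleR_scaleC
        cinner_scaleC_left sum.distrib add_divide_distrib sum_distrib_left[symmetric])
  moreover have "\<phi> B \<le> mat_norm B" for B
  proof -
    have "b (mat_apply B h) \<le> norm (mat_apply B h) * norm k"
      by (rule b_le)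
    also have "\<dots> \<le> (mat_norm B * norm h) * norm k"
      unfolding mat_norm_eq_onorm by (intro mult_right_mono onorm bounded_linear_mat_apply) simp
    finally show ?thesis using h0 k by (simp add: \<phi>_def field_simps)
  qed
  moreover have "mat_norm A - \<epsilon> \<le> \<phi> A"
  proof -
    have "\<phi> A = norm k / norm h"
      using k by (simp add: \<phi>_def k_def[symmetric] b_k)
    then show ?thesis
      using h pos_le_divide_eq[OF h0] unfolding k_def by (metis less_imp_le)
  qed
  ultimately show ?thesis by blast
qed

section \<open>The linear relation generated by an inverse\<close>

text \<open>
  This is the graph of a linear left inverse of $f$ on the span of the image if it is
  single-valued. Figiel's inequality gives this for isometries. Graphs turn the extension by
  continuity into a topological closure.
\<close>

definition inverse_relation :: "('a::real_normed_vector \<Rightarrow> 'b::real_normed_vector) \<Rightarrow> 'a set \<Rightarrow> ('b \<times> 'a) set" where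
  "inverse_relation f X = span ((\<lambda>x. (f x, x)) ` X)"

lemma subspace_closure: "subspace S \<Longrightarrow> subspace (closure S)"
  for S :: "'a::real_normed_vector set"
proof (rule subspaceI)
  assume S: "subspace S"
  show "0 \<in> closure S"
    using subspace_0[OF S] closure_subset by blast
  show "x + y \<in> closure S" if xy: "x \<in> closure S" "y \<in> closure S" for x y
  proof -
    obtain u v where "\<forall>n. u n \<in> S" "u \<longlonglongrightarrow> x" "\<forall>n. v n \<in> S" "v \<longlonglongrightarrow> y"
      using xy unfolding closure_sequential by blast
    then show ?thesis
      unfolding closure_sequential
      by (intro exI[of _ "\<lambda>n. u n + v n"]) (auto intro: subspace_add[OF S] tendsto_add)
  qed
  show "r *\<^sub>R x \<in> closure S" if x: "x \<in> closure S" for r x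
  proof -
    obtain u where "\<forall>n. u n \<in> S" "u \<longlonglongrightarrow> x"
      using x unfolding closure_sequential by blast
    then show ?thesis
      unfolding closure_sequential
      by (intro exI[of _ "\<lambda>n. r *\<^sub>R u n"]) (auto intro: subspace_scale[OF S] tendsto_intros)
  qed
qed

text \<open>
  A contractive linear relation maps convergent sequences to Cauchy sequences, so a limit of
  points of its domain gets a limit of their images.
\<close>

lemma closure_of_contractive_graph_total:
  fixes G :: "('b::real_normed_vector \<times> 'a::banach) set"
  assumes G: "subspace G" and contractive: "\<And>y x. (y, x) \<in> G \<Longrightarrow> norm x \<le> norm y"
    and y: "y \<in> closure (fst ` G)"
  obtains x where "(y, x) \<in> closure G"
proof -
  obtain g where "\<forall>n. g n \<in> fst ` G" and lim: "g \<longlonglongrightarrow> y"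
    using y unfolding closure_sequential by blast
  then have "\<forall>n. \<exists>x. (g n, x) \<in> G" by force
  then obtain h where h: "\<And>n. (g n, h n) \<in> G" by metis
  have dist: "dist (h m) (h n) \<le> dist (g m) (g n)" for m n
    using contractive[of "g m - g n" "h m - h n"] subspace_diff[OF G h[of m] h[of n]]
    by (simp add: dist_norm)
  have "Cauchy g" using lim by (rule LIMSEQ_imp_Cauchy)
  then have "Cauchy h"
    unfolding Cauchy_def using dist by (meson le_less_trans)
  then obtain x where "h \<longlonglongrightarrow> x"
    using Cauchy_convergent convergent_def by blast
  then have "(\<lambda>n. (g n, h n)) \<longlonglongrightarrow> (y, x)"
    using lim by (intro tendsto_Pair)
  then have "(y, x) \<in> closure G"
    using h unfolding closure_sequential by (intro exI[of _ "\<lambda>n. (g n, h n)"]) simp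
  then show ?thesis by (rule that)
qed

lemma matrix_eq_sum_axis:
  "A = (\<Sum>i\<in>UNIV. \<Sum>j\<in>UNIV. axis i (axis j (A $ i $ j)))" for A :: "'a::real_vector^'n::finite^'m::finite"
proof -
  have "(\<Sum>i\<in>UNIV. \<Sum>j\<in>UNIV. axis i (axis j (A $ i $ j))) $ k $ l = A $ k $ l" for k l
  proof -
    have "(\<Sum>j\<in>UNIV. axis i (axis j (A $ i $ j))) $ k $ l = (if i = k then A $ k $ l else 0)" for i
      by (simp add: axis_def if_distrib[of "\<lambda>v. v $ l"] cong: if_cong)
    then show ?thesis by simp
  qed
  then show ?thesis by (simp add: vec_eq_iff)
qed

text \<open>
  A matrix is the sum of its one-entry parts. Because $f(0) = 0$, placing the pair $(f(x), x)$ in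
  the position $(i, j)$ gives a pair of matrices of the form $(f_n(M), M)$, so the relation between
  the entries passes to the matrices.
\<close>

lemma matrix_mem_inverse_relation_amplification:
  fixes f :: "'a::real_normed_vector \<Rightarrow> 'b::real_normed_vector"
    and A :: "'b^'n^'n::finite" and B :: "'a^'n^'n"
  assumes f0: "f 0 = 0" and X0: "0 \<in> X"
    and entries: "\<And>i j. (A $ i $ j, B $ i $ j) \<in> inverse_relation f X"
  shows "(A, B) \<in> inverse_relation (amplification f) {M. \<forall>i j. M $ i $ j \<in> X}"
proof -
  define E :: "'n \<Rightarrow> 'n \<Rightarrow> 'b \<times> 'a \<Rightarrow> ('b^'n^'n) \<times> ('a^'n^'n)"
    where "E i j g = (axis i (axis j (fst g)), axis i (axis j (snd g)))" for i j g
  have lin: "linear (E i j)" for i j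
    by (rule linearI) (simp_all add: E_def axis_def vec_eq_iff)
  have "E i j g \<in> inverse_relation (amplification f) {M. \<forall>i j. M $ i $ j \<in> X}"
    if "g \<in> inverse_relation f X" for i j g
  proof -
    have "E i j (f x, x) = (amplification f (axis i (axis j x)), axis i (axis j x))" for x
      by (simp add: E_def amplification_def axis_def vec_eq_iff f0)
    then have "E i j ` (\<lambda>x. (f x, x)) ` X
        \<subseteq> (\<lambda>M. (amplification f M, M)) ` {M. \<forall>i j. M $ i $ j \<in> X}"
      using X0 by (auto simp: axis_def intro!: image_eqI[OF refl])
    then have "span (E i j ` (\<lambda>x. (f x, x)) ` X) \<subseteq>
        inverse_relation (amplification f) {M. \<forall>i j. M $ i $ j \<in> X}"
      unfolding inverse_relation_def by (rule span_mono)
    then show ?thesis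
      using that unfolding inverse_relation_def linear_span_image[OF lin] by blast
  qed
  then have "(\<Sum>i\<in>UNIV. \<Sum>j\<in>UNIV. E i j (A $ i $ j, B $ i $ j)) \<in>
      inverse_relation (amplification f) {M. \<forall>i j. M $ i $ j \<in> X}"
    using entries unfolding inverse_relation_def by (intro span_sum) blast
  also have "(\<Sum>i\<in>UNIV. \<Sum>j\<in>UNIV. E i j (A $ i $ j, B $ i $ j)) = (A, B)"
    by (rule prod_eqI) (simp_all add: E_def fst_sum snd_sum matrix_eq_sum_axis[symmetric])
  finally show ?thesis .
qed

section \<open>Contractive left inverses\<close>

lemma operator_space_subspace: "operator_space X \<Longrightarrow> subspace X"
proof (rule subspaceI)
  assume X: "operator_space X"
  show "0 \<in> X" "\<And>x y. x \<in> X \<Longrightarrow> y \<in> X \<Longrightarrow> x + y \<in> X"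
    using X by (auto simp: operator_space_def)
  have "r *\<^sub>R A = scaleC_op (complex_of_real r) A" for r and A :: "'a \<Rightarrow>\<^sub>L 'a"
    by (rule blinfun_eqI) (simp add: scaleC_op.rep_eq scaleR_scaleC blinfun.scaleR_left)
  then show "\<And>r x. x \<in> X \<Longrightarrow> r *\<^sub>R x \<in> X"
    using X by (auto simp: operator_space_def)
qed

lemma subspace_matrices_over: "subspace X \<Longrightarrow> subspace (matrices_over X)"
  by (auto simp: subspace_def matrices_over_def)

text \<open>
  On the span this is Figiel's inequality for $f_n$. It passes to the closure because $n$ is
  finite: entrywise approximation is approximation in the operator norm, which is at most the
  sum of the norms of the entries.
\<close>

lemma amplification_isometry_contractive:
  fixes X :: "('h::chilbert_space \<Rightarrow>\<^sub>L 'h) set" and Y :: "('k::chilbert_space \<Rightarrow>\<^sub>L 'k) set"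
    and A :: "('k \<Rightarrow>\<^sub>L 'k)^'n^'n::finite" and B :: "('h \<Rightarrow>\<^sub>L 'h)^'n^'n"
  assumes X: "subspace X" and iso: "n_isometry TYPE('n) X Y f" and f0: "f 0 = 0"
    and entries: "\<And>i j. (A $ i $ j, B $ i $ j) \<in> closure (inverse_relation f X)"
  shows "mat_norm B \<le> mat_norm A"
proof -
  have amp0: "amplification f (0 :: ('h \<Rightarrow>\<^sub>L 'h)^'n^'n) = 0"
    by (simp add: amplification_def vec_eq_iff f0)
  have on_graph: "mat_norm B \<le> mat_norm A"
    if "\<And>i j. (A $ i $ j, B $ i $ j) \<in> inverse_relation f X"
    for A :: "('k \<Rightarrow>\<^sub>L 'k)^'n^'n" and B :: "('h \<Rightarrow>\<^sub>L 'h)^'n^'n"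
  proof (rule figiel_span[where p = mat_norm and q = mat_norm and f = "amplification f" and X = "matrices_over X"])
    show "subspace (matrices_over X :: (('h \<Rightarrow>\<^sub>L 'h)^'n^'n) set)"
      by (rule subspace_matrices_over[OF X])
    show "(A, B) \<in> span ((\<lambda>M. (amplification f M, M)) ` matrices_over X)"
      using matrix_mem_inverse_relation_amplification[OF f0 subspace_0[OF X] that]
      by (simp add: inverse_relation_def matrices_over_def)
    show "mat_norm (amplification f M - amplification f N) = mat_norm (M - N)"
      if "M \<in> matrices_over X" "N \<in> matrices_over X" for M N :: "('h \<Rightarrow>\<^sub>L 'h)^'n^'n"
      using iso that by (simp add: n_isometry_def)
  qed (fact mat_norm_triangle mat_norm_scaleR mat_norm_norming amp0)+
  \<comment> \<open>Each of the two approximations below changes $n^2$ entries by at most $\varepsilon$.\<close>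
  define c where "c = 2 * real CARD('n) * real CARD('n)"
  have c: "c > 0" by (simp add: c_def)
  have "mat_norm B \<le> mat_norm A + c * \<epsilon>" if \<epsilon>: "\<epsilon> > 0" for \<epsilon>
  proof -
    have "\<exists>g\<in>inverse_relation f X. dist g (A $ i $ j, B $ i $ j) < \<epsilon>" for i j
      using entries[of i j] \<epsilon> unfolding closure_approachable by blast
    then obtain g where g: "\<And>i j. g i j \<in> inverse_relation f X"
      "\<And>i j. dist (g i j) (A $ i $ j, B $ i $ j) < \<epsilon>" by metis
    define A' :: "('k \<Rightarrow>\<^sub>L 'k)^'n^'n" where "A' = (\<chi> i j. fst (g i j))"
    define B' :: "('h \<Rightarrow>\<^sub>L 'h)^'n^'n" where "B' = (\<chi> i j. snd (g i j))"
    have AA: "norm ((A' - A) $ i $ j) \<le> \<epsilon>" for i j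
      using dist_fst_le[of "g i j" "(A $ i $ j, B $ i $ j)"] g(2)[of i j]
      by (simp add: A'_def dist_norm)
    have BB: "norm ((B - B') $ i $ j) \<le> \<epsilon>" for i j
      using dist_snd_le[of "g i j" "(A $ i $ j, B $ i $ j)"] g(2)[of i j]
      by (simp add: B'_def dist_norm norm_minus_commute)
    have small: "(\<Sum>i\<in>(UNIV :: 'n set). \<Sum>j\<in>(UNIV :: 'n set). m i j) \<le> c / 2 * \<epsilon>"
      if "\<And>i j. m i j \<le> \<epsilon>" for m
    proof -
      have "(\<Sum>i\<in>(UNIV :: 'n set). \<Sum>j\<in>(UNIV :: 'n set). m i j) \<le> (\<Sum>i\<in>(UNIV :: 'n set). \<Sum>j\<in>(UNIV :: 'n set). \<epsilon>)"
        by (intro sum_mono that)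
      then show ?thesis by (simp add: c_def)
    qed
    have "mat_norm B \<le> mat_norm B' + mat_norm (B - B')"
      using mat_norm_triangle[of B' "B - B'"] by simp
    also have "mat_norm B' \<le> mat_norm A'"
      using g(1) by (intro on_graph) (simp add: A'_def B'_def)
    also have "mat_norm A' \<le> mat_norm A + mat_norm (A' - A)"
      using mat_norm_triangle[of A "A' - A"] by simp
    also have "mat_norm (A' - A) \<le> c / 2 * \<epsilon>"
      by (rule order_trans[OF mat_norm_le_sum small[OF AA]])
    also have "mat_norm (B - B') \<le> c / 2 * \<epsilon>"
      by (rule order_trans[OF mat_norm_le_sum small[OF BB]])
    finally show ?thesis by (simp add: mult.commute)
  qed
  note approx = this
  show ?thesis
  proof (rule field_le_epsilon)
    fix e :: real assume "e > 0"
    then show "mat_norm B \<le> mat_norm A + e"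
      using approx[of "e / c"] c by simp
  qed
qed

lemma norm_le_mat_norm_axis: "norm x \<le> mat_norm (axis i (axis j x))"
  using norm_entry_le_mat_norm[of "axis i (axis j x)" i j] by simp

lemma mat_norm_axis_le: "mat_norm (axis i (axis j x)) \<le> norm x"
proof -
  have "(\<Sum>k\<in>UNIV. \<Sum>l\<in>UNIV. norm ((axis i (axis j x)) $ k $ l)) = norm x"
  proof -
    have "(\<Sum>l\<in>UNIV. norm ((axis i (axis j x)) $ k $ l)) = (if k = i then norm x else 0)" for k
      by (simp add: axis_def if_distrib[of norm] cong: if_cong)
    then show ?thesis by simp
  qed
  then show ?thesis using mat_norm_le_sum[of "axis i (axis j x)"] by simp
qed

lemma amplification_norm_le_one_bound:
  assumes "amplification_norm TYPE('n::finite) Y T \<le> 1"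
    and "A \<in> matrices_over Y" and "mat_norm (A :: ('k::chilbert_space \<Rightarrow>\<^sub>L 'k)^'n^'n) \<le> 1"
  shows "mat_norm (amplification T A) \<le> 1"
proof -
  have "ereal (mat_norm (amplification T A)) \<le> amplification_norm TYPE('n) Y T"
    unfolding amplification_norm_def using assms(2,3) by (intro SUP_upper) simp
  then have "ereal (mat_norm (amplification T A)) \<le> ereal 1"
    using assms(1) unfolding one_ereal_def by (rule order_trans)
  then show ?thesis by simp
qed

text \<open>
  A one-entry matrix has the norm of its entry, so the bound on the amplification applies to
  the map itself.
\<close>

lemma amplification_norm_le_one_contractive:
  assumes Y: "subspace Y" and T: "real_linear_on Y T"
    and norm: "amplification_norm TYPE('n::finite) Y T \<le> 1" and y: "y \<in> Y"
  shows "norm (T y) \<le> norm y"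
proof (cases "y = 0")
  case True
  then show ?thesis
    using T subspace_0[OF Y] unfolding real_linear_on_def by (metis order_refl scaleR_zero_left norm_zero)
next
  case False
  define u where "u = (1 / norm y) *\<^sub>R y"
  have u: "u \<in> Y" "norm u = 1"
    using False subspace_scale[OF Y y] by (simp_all add: u_def)
  obtain i :: 'n where True by blast
  have "(axis i (axis i u) :: _^'n^'n) \<in> matrices_over Y"
    using u(1) subspace_0[OF Y] by (simp add: matrices_over_def axis_def)
  moreover have "mat_norm (axis i (axis i u) :: _^'n^'n) \<le> 1"
    using mat_norm_axis_le[of i i u] u(2) by simp
  ultimately have "mat_norm (amplification T (axis i (axis i u) :: _^'n^'n)) \<le> 1"
    by (rule amplification_norm_le_one_bound[OF norm])
  moreover have "T u = amplification T (axis i (axis i u) :: _^'n^'n) $ i $ i"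
    by (simp add: amplification_def)
  ultimately have "norm (T u) \<le> 1"
    using norm_entry_le_mat_norm order_trans by metis
  moreover have "T u = (1 / norm y) *\<^sub>R T y"
    using T y by (simp add: u_def real_linear_on_def)
  ultimately show ?thesis using False by (simp add: field_simps)
qed

text \<open>
  A linear left inverse is prescribed on the span of $f(X)$, and continuity leaves no choice on
  the closure. Hence all contractive linear left inverses have their graphs in the same closed relation.
\<close>

lemma left_inverse_relation:
  assumes Y: "subspace Y" "closure (span (f ` X)) = Y"
    and T: "real_linear_on Y T" and contractive: "\<And>y. y \<in> Y \<Longrightarrow> norm (T y) \<le> norm y"
    and left_inverse: "\<And>x. x \<in> X \<Longrightarrow> T (f x) = x" and y: "y \<in> Y"
  shows "(y, T y) \<in> closure (inverse_relation f X)"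
  unfolding closure_approachable
proof (intro allI impI)
  fix \<epsilon> :: real assume \<epsilon>: "\<epsilon> > 0"
  have T_add: "T (a + b) = T a + T b" if "a \<in> Y" "b \<in> Y" for a b
    using T that by (simp add: real_linear_on_def)
  have T_scale: "T (r *\<^sub>R a) = r *\<^sub>R T a" if "a \<in> Y" for r a
    using T that by (simp add: real_linear_on_def)
  have T_0: "T 0 = 0"
    using T_scale[OF subspace_0[OF Y(1)], of 0] by simp
  have graph: "a \<in> Y \<and> (a, T a) \<in> inverse_relation f X" if "a \<in> span (f ` X)" for a
    using that
  proof (induction rule: span_induct_alt)
    case base
    then show ?case
      using subspace_0[OF Y(1)] span_zero by (auto simp: T_0 inverse_relation_def zero_prod_def[symmetric])
  next
    case (step c a b)
    then obtain x where x: "x \<in> X" "a = f x" by blast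
    have a: "a \<in> Y"
      using subsetD[OF closure_subset span_base[OF step(1)]] Y(2) by simp
    have ca: "c *\<^sub>R a \<in> Y" using subspace_scale[OF Y(1) a] .
    have "(a, T a) \<in> inverse_relation f X"
      using x by (auto simp: inverse_relation_def left_inverse intro!: span_base)
    then have "c *\<^sub>R (a, T a) + (b, T b) \<in> inverse_relation f X"
      using step(2) unfolding inverse_relation_def by (intro span_add span_scale) auto
    then show ?case
      using step(2) ca subspace_add[OF Y(1) ca] by (simp add: T_add T_scale a)
  qed
  obtain a where a: "a \<in> span (f ` X)" "dist a y < \<epsilon> / 2"
    using y \<epsilon> unfolding Y(2)[symmetric] closure_approachable by (metis half_gt_zero)
  have "a - y \<in> Y"
    using graph[OF a(1)] subspace_diff[OF Y(1) _ y] by blast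
  then have "norm (T a - T y) \<le> norm (a - y)"
    using contractive[of "a - y"] T_add[of "a - y" y] y by simp
  then have "dist (a, T a) (y, T y) \<le> 2 * dist a y"
    using norm_Pair_le[of "a - y" "T a - T y"] by (simp add: dist_norm)
  then show "\<exists>g\<in>inverse_relation f X. dist g (y, T y) < \<epsilon>"
    using graph[OF a(1)] a(2) by (intro bexI[of _ "(a, T a)"]) auto
qed

section \<open>The unique left inverse of an n-isometry\<close>

theorem proposition4p6:
  fixes X :: "('h::chilbert_space \<Rightarrow>\<^sub>L 'h) set"
    and Y :: "('k::chilbert_space \<Rightarrow>\<^sub>L 'k) set"
    and f :: "('h \<Rightarrow>\<^sub>L 'h) \<Rightarrow> ('k \<Rightarrow>\<^sub>L 'k)"
  assumes "operator_space X" and "operator_space Y"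
    and "X \<noteq> {0}"
    and "n_isometry TYPE('n::finite) X Y f"
    and "closure (span (f ` X)) = Y"
    and "f 0 = 0"
  shows "\<exists>!T. T \<in> Y \<rightarrow>\<^sub>E X \<and> real_linear_on Y T \<and>
           amplification_norm TYPE('n) Y T = 1 \<and> (\<forall>x\<in>X. T (f x) = x)"
proof -
  note X = operator_space_subspace[OF assms(1)] and Y = operator_space_subspace[OF assms(2)]
    and iso = assms(4) and Y_span = assms(5) and f0 = assms(6)
  have fX: "f x \<in> Y" if "x \<in> X" for x
    using iso that by (auto simp: n_isometry_def)
  define G where "G = closure (inverse_relation f X)"
  have G: "subspace G"
    unfolding G_def inverse_relation_def by (intro subspace_closure subspace_span)
  have G_contractive: "norm x \<le> norm y" if "(y, x) \<in> G" for y x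
  proof -
    obtain i :: 'n where True by blast
    have "(0, 0) \<in> G" using subspace_0[OF G] by (simp add: zero_prod_def)
    then have "mat_norm (axis i (axis i x) :: _^'n^'n) \<le> mat_norm (axis i (axis i y) :: _^'n^'n)"
      using that unfolding G_def
      by (intro amplification_isometry_contractive[OF X iso f0]) (simp add: axis_def)
    then show ?thesis
      using norm_le_mat_norm_axis[of x i i] mat_norm_axis_le[of i i y] by linarith
  qed
  have G_unique: "x = x'" if "(y, x) \<in> G" "(y, x') \<in> G" for y x x'
    using G_contractive[of 0 "x - x'"] subspace_diff[OF G that] by simp
  have G_total: "\<exists>x. (y, x) \<in> G" if "y \<in> Y" for y
  proof (rule closure_of_contractive_graph_total[where G = "inverse_relation f X"])
    show "subspace (inverse_relation f X)"
      unfolding inverse_relation_def by (rule subspace_span)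
    show "norm x \<le> norm y" if "(y, x) \<in> inverse_relation f X" for y x
      using that closure_subset by (intro G_contractive) (auto simp: G_def)
    have "fst ` inverse_relation f X = span (f ` X)"
      unfolding inverse_relation_def
      by (simp add: linear_span_image[OF bounded_linear.linear[OF bounded_linear_fst], symmetric] image_image)
    then show "y \<in> closure (fst ` inverse_relation f X)"
      using that Y_span by simp
  qed (auto simp: G_def)
  have G_X: "x \<in> X" if "(y, x) \<in> G" for y x
  proof -
    have "G \<subseteq> snd -` X"
      unfolding G_def inverse_relation_def
    proof (intro closure_minimal span_minimal)
      show "subspace (snd -` X :: (('k \<Rightarrow>\<^sub>L 'k) \<times> ('h \<Rightarrow>\<^sub>L 'h)) set)"
        by (rule linear_subspace_vimage[OF bounded_linear.linear[OF bounded_linear_snd] X])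
      show "closed (snd -` X :: (('k \<Rightarrow>\<^sub>L 'k) \<times> ('h \<Rightarrow>\<^sub>L 'h)) set)"
        using assms(1) by (intro closed_vimage_snd) (simp add: operator_space_def)
    qed auto
    then show ?thesis using that by auto
  qed
  have G_f: "(f x, x) \<in> G" if "x \<in> X" for x
    unfolding G_def inverse_relation_def
    by (rule subsetD[OF closure_subset span_base[OF imageI[OF that]]])
  define T where "T = restrict (\<lambda>y. THE x. (y, x) \<in> G) Y"
  have T_eq: "T y = x" if "(y, x) \<in> G" "y \<in> Y" for y x
    using that G_unique by (auto simp: T_def intro!: the_equality)
  have T_G: "(y, T y) \<in> G" if "y \<in> Y" for y
    using G_total[OF that] T_eq[OF _ that] by auto
  have T_f: "T (f x) = x" if "x \<in> X" for x
    using T_eq[OF G_f[OF that] fX[OF that]] .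
  have T_in: "T \<in> Y \<rightarrow>\<^sub>E X"
    using G_X[OF T_G] by (auto simp: T_def)
  have T_linear: "real_linear_on Y T"
    unfolding real_linear_on_def
  proof (intro conjI ballI allI)
    show "T (x + y) = T x + T y" if "x \<in> Y" "y \<in> Y" for x y
      using subspace_add[OF G T_G[OF that(1)] T_G[OF that(2)]] subspace_add[OF Y that]
      by (intro T_eq) auto
    show "T (r *\<^sub>R y) = r *\<^sub>R T y" if "y \<in> Y" for r y
      using subspace_scale[OF G T_G[OF that]] subspace_scale[OF Y that]
      by (intro T_eq) auto
  qed
  have T_norm: "amplification_norm TYPE('n) Y T = 1"
  proof (rule antisym)
    have "mat_norm (amplification T A) \<le> mat_norm A" if "A \<in> matrices_over Y"
      for A :: "('k \<Rightarrow>\<^sub>L 'k)^'n^'n"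
      using T_G that unfolding G_def
      by (intro amplification_isometry_contractive[OF X iso f0])
        (auto simp: amplification_def matrices_over_def)
    then show "amplification_norm TYPE('n) Y T \<le> 1"
      unfolding amplification_norm_def one_ereal_def
      by (intro SUP_least) (auto intro: order_trans)
    \<comment> \<open>The norm one is attained at $f_n(M)$ for every $M$ of norm one over $X$; some $M$ exists as $X \neq \{0\}$.\<close>
    obtain x where x: "x \<in> X" "x \<noteq> 0"
      using assms(3) subspace_0[OF X] by blast
    obtain i :: 'n where True by blast
    define M :: "('h \<Rightarrow>\<^sub>L 'h)^'n^'n" where
      "M = (1 / mat_norm (axis i (axis i x) :: _^'n^'n)) *\<^sub>R axis i (axis i x)"
    have "mat_norm (axis i (axis i x) :: _^'n^'n) > 0"
      using norm_le_mat_norm_axis[of x i i] x(2) by (smt (verit) zero_less_norm_iff)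
    then have M: "mat_norm M = 1"
      by (simp add: M_def mat_norm_scaleR)
    have MX: "M \<in> matrices_over X"
      unfolding M_def
      by (intro subspace_scale subspace_matrices_over X)
        (use x subspace_0[OF X] in \<open>simp add: matrices_over_def axis_def\<close>)
    have "amplification f (0 :: ('h \<Rightarrow>\<^sub>L 'h)^'n^'n) = 0"
      by (simp add: amplification_def vec_eq_iff f0)
    moreover have "mat_norm (amplification f M - amplification f 0) = mat_norm (M - 0)"
      using iso MX subspace_0[OF subspace_matrices_over[OF X]] unfolding n_isometry_def by blast
    ultimately have fM: "mat_norm (amplification f M) = 1"
      by (simp add: M)
    have "amplification T (amplification f M) = M"
      using MX by (simp add: amplification_def vec_eq_iff matrices_over_def T_f)
    then have "ereal (mat_norm (amplification T (amplification f M))) = 1"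
      by (simp add: M one_ereal_def)
    moreover have "amplification f M \<in> matrices_over Y"
      using MX fX by (simp add: amplification_def matrices_over_def)
    ultimately show "1 \<le> amplification_norm TYPE('n) Y T"
      unfolding amplification_norm_def using fM by (intro SUP_upper2) auto
  qed
  show ?thesis
  proof (rule ex1I)
    show "T \<in> Y \<rightarrow>\<^sub>E X \<and> real_linear_on Y T \<and>
        amplification_norm TYPE('n) Y T = 1 \<and> (\<forall>x\<in>X. T (f x) = x)"
      using T_in T_linear T_norm T_f by blast
  next
    fix S assume S: "S \<in> Y \<rightarrow>\<^sub>E X \<and> real_linear_on Y S \<and>
        amplification_norm TYPE('n) Y S = 1 \<and> (\<forall>x\<in>X. S (f x) = x)"
    have "norm (S y) \<le> norm y" if "y \<in> Y" for y
      using S that by (intro amplification_norm_le_one_contractive[where 'n = 'n, OF Y]) auto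
    then have "(y, S y) \<in> G" if "y \<in> Y" for y
      unfolding G_def using S that by (intro left_inverse_relation[OF Y Y_span]) auto
    then have "S y = T y" if "y \<in> Y" for y
      using T_eq that by metis
    then show "S = T"
      using S T_in by (intro PiE_ext[of S Y "\<lambda>_. X" T]) auto
  qed
qed

end
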